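(* Let $F=f+\Psi$ where $f:\mathbb{R}^n\to\mathbb{R}$ is $L$-smooth ($L>0$) and convex and $\Psi:\mathbb{R}^n\to\mathbb{R}\cup\{+\infty\}$ is closed, proper and convex, and suppose $F$ attains its minimum at a fixed point $\mathbf{x}^*$. Let $\mathbf{z}_0,\mathbf{y}_1\in\mathbb{R}^n$. Then the iterates $\{\mathbf{z}_k,\mathbf{y}_k\}$ generated by the geometric descent algorithm described in the context satisfy, for all $k\ge1$, $$\|\mathbf{y}_{k+1}-\mathbf{x}^*\|^2+\frac{(k+1)(k+2)}{2L}(F(\bar{\mathbf{z}}_k)-F(\mathbf{x}^* ))\le\|\mathbf{y}_k-\mathbf{x}^*\|^2+\frac{k(k+1)}{2L}(F(\bar{\mathbf{z}}_{k-1})-F(\mathbf{x}^* )).$$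
   Context: $f$ is $L$-smooth if it is differentiable and $|f(\mathbf{x})-f(\mathbf{y})-\nabla f(\mathbf{y})^T(\mathbf{x}-\mathbf{y})|\le (L/2)\|\mathbf{x}-\mathbf{y}\|^2$ for all $\mathbf{x},\mathbf{y}$. For $t>0$, $\mathrm{prox}_{t\Psi}(\mathbf{x})=\operatorname{argmin}_{\mathbf{z}}\{\Psi(\mathbf{z})+\|\mathbf{x}-\mathbf{z}\|^2/(2t)\}$, and $G_t(\mathbf{x})=t^{-1}(\mathbf{x}-\mathrm{prox}_{t\Psi}(\mathbf{x}-t\nabla f(\mathbf{x})))$. Write $\bar{\mathbf{z}}_k=\mathbf{z}_k-\frac1L G_{1/L}(\mathbf{z}_k)$ for $k\ge0$. Geometric descent (non-strongly convex and nonconvex case). Given $\mathbf{z}_0,\mathbf{y}_1\in\mathbb{R}^n$, for $k=1,2,\ldots$: set $\gamma_k=\frac{k+1}{2L}$; let $\mathbf{z}_k\in\mathrm{aff}\{\bar{\mathbf{z}}_{k-1},\mathbf{y}_k\}$ be any point with $G_{1/L}(\mathbf{z}_k)^T(\mathbf{y}_k-\mathbf{z}_k)\ge0$ and $-G_{1/L}(\mathbf{z}_k)^T(\bar{\mathbf{z}}_{k-1}-\mathbf{z}_k)\le0$; set $\mathbf{y}_{k+1}=\mathbf{y}_k-\gamma_kG_{1/L}(\mathbf{z}_k)$. *)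

theory Defs
  imports "HOL-Analysis.Analysis"
begin

text \<open>
  Extended-valued functions have values in \<^typ>\<open>ereal\<close>.  Proper functions never take the value
  \<open>-\<infinity>\<close> and are finite somewhere; closedness and convexity are those of the epigraph.
\<close>

definition ereal_epigraph :: "('a \<Rightarrow> ereal) \<Rightarrow> ('a \<times> real) set" where
  "ereal_epigraph \<Psi> = {(x, r). \<Psi> x \<le> ereal r}"

definition proper_fun :: "('a \<Rightarrow> ereal) \<Rightarrow> bool" where
  "proper_fun \<Psi> \<longleftrightarrow> (\<forall>x. \<Psi> x \<noteq> -\<infinity>) \<and> (\<exists>x. \<Psi> x \<noteq> \<infinity>)"

definition closed_fun :: "('a::topological_space \<Rightarrow> ereal) \<Rightarrow> bool" where
  "closed_fun \<Psi> \<longleftrightarrow> closed (ereal_epigraph \<Psi>)"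

definition convex_fun :: "('a::real_vector \<Rightarrow> ereal) \<Rightarrow> bool" where
  "convex_fun \<Psi> \<longleftrightarrow> convex (ereal_epigraph \<Psi>)"

definition gradient :: "('a::real_inner \<Rightarrow> real) \<Rightarrow> 'a \<Rightarrow> 'a" where
  "gradient f x = (THE D. GDERIV f x :> D)"

definition L_smooth :: "real \<Rightarrow> ('a::real_inner \<Rightarrow> real) \<Rightarrow> bool" where
  "L_smooth L f \<longleftrightarrow>
     (\<forall>x. f differentiable (at x)) \<and>
     (\<forall>x y. \<bar>f x - f y - gradient f y \<bullet> (x - y)\<bar> \<le> L / 2 * (norm (x - y))\<^sup>2)"

text \<open>
  The constant \<^const>\<open>arg_min\<close> selects some minimiser; for closed, proper and convex \<open>\<Psi>\<close> on
  a Euclidean space and \<open>t > 0\<close> the minimiser exists and is unique.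
\<close>

definition prox :: "real \<Rightarrow> ('a::real_inner \<Rightarrow> ereal) \<Rightarrow> 'a \<Rightarrow> 'a" where
  "prox t \<Psi> x = (ARG_MIN (\<lambda>z. \<Psi> z + ereal ((norm (x - z))\<^sup>2 / (2 * t))) z. True)"

definition grad_map :: "real \<Rightarrow> ('a::real_inner \<Rightarrow> real) \<Rightarrow> ('a \<Rightarrow> ereal) \<Rightarrow> 'a \<Rightarrow> 'a" where
  "grad_map t f \<Psi> x = (1 / t) *\<^sub>R (x - prox t \<Psi> (x - t *\<^sub>R gradient f x))"

definition prox_step :: "real \<Rightarrow> ('a::real_inner \<Rightarrow> real) \<Rightarrow> ('a \<Rightarrow> ereal) \<Rightarrow> 'a \<Rightarrow> 'a" where
  "prox_step L f \<Psi> x = x - (1 / L) *\<^sub>R grad_map (1 / L) f \<Psi> x"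

definition composite :: "('a \<Rightarrow> real) \<Rightarrow> ('a \<Rightarrow> ereal) \<Rightarrow> 'a \<Rightarrow> ereal" where
  "composite f \<Psi> x = ereal (f x) + \<Psi> x"

text \<open>
  The choice of \<open>z k\<close> is not deterministic, so a run of the method is a pair of sequences
  satisfying its rules.  The indices of \<open>y\<close> start at \<open>1\<close>; the value \<open>y 0\<close> is irrelevant.
\<close>

definition geometric_descent ::
  "real \<Rightarrow> ('a::real_inner \<Rightarrow> real) \<Rightarrow> ('a \<Rightarrow> ereal) \<Rightarrow> 'a \<Rightarrow> 'a \<Rightarrow>
     (nat \<Rightarrow> 'a) \<Rightarrow> (nat \<Rightarrow> 'a) \<Rightarrow> bool" where
  "geometric_descent L f \<Psi> z0 y1 z y \<longleftrightarrow>
     z 0 = z0 \<and> y 1 = y1 \<and>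
     (\<forall>k\<ge>1.
        z k \<in> affine hull {prox_step L f \<Psi> (z (k - 1)), y k} \<and>
        grad_map (1 / L) f \<Psi> (z k) \<bullet> (y k - z k) \<ge> 0 \<and>
        - (grad_map (1 / L) f \<Psi> (z k) \<bullet> (prox_step L f \<Psi> (z (k - 1)) - z k)) \<le> 0 \<and>
        y (k + 1) = y k - ((real k + 1) / (2 * L)) *\<^sub>R grad_map (1 / L) f \<Psi> (z k))"

end

theory Submission imports Defs begin

text \<open>
  With \<open>G = G\<^bsub>1/L\<^esub>(z)\<close> and \<open>p = z - G/L\<close>, optimality of the proximal point, convexity of \<open>f\<close>
  and the quadratic upper bound at \<open>z\<close> add up to
  \<open>F x \<ge> F p + G \<bullet> (x - z) + \<parallel>G\<parallel>\<^sup>2 / (2 L)\<close> for every \<open>x\<close>.  Expanding \<open>\<parallel>y\<^bsub>k+1\<^esub> - x*\<parallel>\<^sup>2\<close> and using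
  this inequality at \<open>x*\<close> and, with weight \<open>k (k + 1) / (2 L)\<close>, at the previous proximal point,
  leaves the nonpositive remainder \<open>- (k + 1) \<parallel>G\<parallel>\<^sup>2 / (4 L\<^sup>2)\<close>.  The minimiser of \<open>F\<close> supplies an
  affine minorant of \<open>\<Psi>\<close>, which makes the proximal objective coercive.
\<close>

section \<open>First-order inequalities from convexity\<close>

text \<open>Divide by \<open>t\<close> and let \<open>t\<close> tend to 0. This turns an inequality
  along a segment with a second-order error into an exact first-order one.\<close>

lemma nonpos_if_scaled_le_square:
  fixes a b :: real
  assumes "\<And>t. 0 < t \<Longrightarrow> t \<le> 1 \<Longrightarrow> t * a \<le> t\<^sup>2 * b"
  shows "a \<le> 0"
proof (rule ccontr)
  assume "\<not> a \<le> 0"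
  then have a: "a > 0" by simp
  \<comment> \<open>Small enough that \<open>t * (\<bar>b\<bar> + 1)\<close> is at most
    \<open>a / 2\<close>; the added 1 keeps the denominator positive.\<close>
  define t where "t = min 1 (a / (2 * (\<bar>b\<bar> + 1)))"
  have t: "0 < t" "t \<le> 1" using a by (auto simp: t_def)
  have "t * a \<le> t * (t * b)" using assms[OF t] by (simp add: power2_eq_square mult.assoc)
  then have "a \<le> t * b" using t by simp
  also have "\<dots> \<le> t * (\<bar>b\<bar> + 1)" using t by (intro mult_left_mono) auto
  also have "\<dots> \<le> a / (2 * (\<bar>b\<bar> + 1)) * (\<bar>b\<bar> + 1)" by (intro mult_right_mono) (auto simp: t_def)
  also have "\<dots> = a / 2" by (simp add: field_simps)
  finally show False using a by simp
qed

lemma convex_fun_segment: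
  assumes "convex_fun \<Psi>" "\<Psi> x \<le> ereal a" "\<Psi> y \<le> ereal b" "0 \<le> u" "u \<le> 1"
  shows "\<Psi> (x + u *\<^sub>R (y - x)) \<le> ereal (a + u * (b - a))"
proof -
  have "(1 - u) *\<^sub>R (x, a) + u *\<^sub>R (y, b) \<in> ereal_epigraph \<Psi>"
    using assms unfolding convex_fun_def
    by (intro convexD) (auto simp: ereal_epigraph_def)
  moreover have "(1 - u) *\<^sub>R (x, a) + u *\<^sub>R (y, b) = (x + u *\<^sub>R (y - x), a + u * (b - a))"
    by (simp add: algebra_simps)
  ultimately show ?thesis by (simp add: ereal_epigraph_def)
qed

text \<open>Moving from \<open>p\<close> a fraction \<open>t\<close> towards \<open>x\<close>
  changes \<open>g\<close> to first order by \<open>t * (D \<bullet> (x - p))\<close> with an error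
  of order \<open>t\<^sup>2\<close>, so minimality of \<open>p\<close> makes \<open>- D\<close> a
  subgradient of \<open>\<Psi>\<close> at \<open>p\<close>. It serves both \<open>f\<close> at the
  minimiser and the squared distance in the proximal objective.\<close>

lemma composite_minimizer_subgradient:
  fixes \<Psi> :: "'a::real_inner \<Rightarrow> ereal"
  assumes conv: "convex_fun \<Psi>" and p: "\<Psi> p = ereal a"
    and min: "\<And>u. composite g \<Psi> p \<le> composite g \<Psi> u"
    and quad: "\<And>u. g u \<le> g p + D \<bullet> (u - p) + C * (norm (u - p))\<^sup>2"
  shows "ereal (a - D \<bullet> (x - p)) \<le> \<Psi> x"
\<comment> \<open>Testing against real upper bounds \<open>b\<close> makes the case of an infinite
  \<open>\<Psi> x\<close> vacuous.\<close>
proof (rule ereal_le_real)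
  fix b assume b: "\<Psi> x \<le> ereal b"
  have "t * (a - D \<bullet> (x - p) - b) \<le> t\<^sup>2 * (C * (norm (x - p))\<^sup>2)" if t: "0 < t" "t \<le> 1" for t
  proof -
    define u where "u = p + t *\<^sub>R (x - p)"
    have "\<Psi> u \<le> ereal (a + t * (b - a))"
      unfolding u_def using convex_fun_segment[OF conv _ b] p t by simp
    then have "ereal (g u) + \<Psi> u \<le> ereal (g u) + ereal (a + t * (b - a))"
      by (rule add_left_mono)
    with min[of u] have "ereal (g p) + ereal a \<le> ereal (g u) + ereal (a + t * (b - a))"
      unfolding composite_def p by (rule order_trans)
    then have "g p + a \<le> g u + (a + t * (b - a))" by simp
    moreover have "g u \<le> g p + t * (D \<bullet> (x - p)) + C * (t\<^sup>2 * (norm (x - p))\<^sup>2)"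
      using quad[of u] by (simp add: u_def power_mult_distrib)
    ultimately show ?thesis by (simp add: algebra_simps)
  qed
  then have "a - D \<bullet> (x - p) - b \<le> 0" by (rule nonpos_if_scaled_le_square)
  then show "ereal (a - D \<bullet> (x - p)) \<le> ereal b" by simp
qed

text \<open>On the segment from \<open>y\<close> to \<open>x\<close> the chord bounds
  \<open>f\<close> from above and the tangent, up to an error of order \<open>t\<^sup>2\<close>,
  from below.\<close>

lemma convex_L_smooth_gradient_le:
  assumes L: "L_smooth L f" and conv: "convex_on UNIV f"
  shows "f y + gradient f y \<bullet> (x - y) \<le> f x"
proof -
  have "t * (f y + gradient f y \<bullet> (x - y) - f x) \<le> t\<^sup>2 * (L / 2 * (norm (x - y))\<^sup>2)"
    if t: "0 < t" "t \<le> 1" for t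
  proof -
    define u where "u = (1 - t) *\<^sub>R y + t *\<^sub>R x"
    have "f u \<le> (1 - t) * f y + t * f x"
      unfolding u_def using convex_onD[OF conv] t by simp
    moreover have "\<bar>f u - f y - gradient f y \<bullet> (u - y)\<bar> \<le> L / 2 * (norm (u - y))\<^sup>2"
      using L by (simp add: L_smooth_def)
    moreover have uy: "u - y = t *\<^sub>R (x - y)" by (simp add: u_def algebra_simps)
    moreover have "gradient f y \<bullet> (u - y) = t * (gradient f y \<bullet> (x - y))" by (simp add: uy)
    moreover have "L / 2 * (norm (u - y))\<^sup>2 = t\<^sup>2 * (L / 2 * (norm (x - y))\<^sup>2)"
      by (simp add: uy power_mult_distrib)
    moreover have "(1 - t) * f y + t * f x = f y + t * f x - t * f y"
      "t * (f y + gradient f y \<bullet> (x - y) - f x)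
        = t * f y + t * (gradient f y \<bullet> (x - y)) - t * f x" by (simp_all add: algebra_simps)
    ultimately show ?thesis by linarith
  qed
  then have "f y + gradient f y \<bullet> (x - y) - f x \<le> 0" by (rule nonpos_if_scaled_le_square)
  then show ?thesis by simp
qed

section \<open>Existence and optimality of the proximal point\<close>

text \<open>The choice in \<open>prox\<close> is meaningful only once a minimiser exists. Existence
  is Weierstrass on a sublevel set inside the epigraph, compact because the quadratic outgrows the
  affine minorant.\<close>

lemma prox_minimizer:
  fixes \<Psi> :: "'a::euclidean_space \<Rightarrow> ereal"
  assumes t: "t > 0" and closed: "closed_fun \<Psi>" and q: "\<Psi> q \<noteq> \<infinity>"
    and minorant: "\<And>z. ereal (c + D \<bullet> z) \<le> \<Psi> z"
  shows "\<Psi> (prox t \<Psi> x) + ereal ((norm (x - prox t \<Psi> x))\<^sup>2 / (2 * t))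
    \<le> \<Psi> z + ereal ((norm (x - z))\<^sup>2 / (2 * t))"
proof -
  define \<phi> where "\<phi> = (\<lambda>z. \<Psi> z + ereal ((norm (x - z))\<^sup>2 / (2 * t)))"
  \<comment> \<open>Unlike \<open>\<phi>\<close>, this function on pairs is real-valued and
    continuous; minimising it over the closed epigraph replaces an argument by lower
    semicontinuity.\<close>
  define h where "h = (\<lambda>(z, r). r + (norm (x - z))\<^sup>2 / (2 * t))"
  have "\<Psi> q \<noteq> -\<infinity>" using minorant[of q] by auto
  with q obtain a where a: "\<Psi> q = ereal a" by (cases "\<Psi> q") auto
  define M where "M = h (q, a)"
  define K where "K = {w \<in> ereal_epigraph \<Psi>. h w \<le> M}"
  have cont: "continuous_on S h" for S
    unfolding h_def case_prod_unfold using t by (intro continuous_intros) auto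
  have "K = ereal_epigraph \<Psi> \<inter> {w. h w \<le> M}" by (auto simp: K_def)
  moreover have "closed {w. h w \<le> M}"
    by (intro closed_Collect_le cont continuous_on_const)
  ultimately have "closed K" using closed by (simp add: closed_fun_def closed_Int)
  moreover have "bounded K"
  proof -
    \<comment> \<open>\<open>c'\<close> is the value of the minorant at \<open>x\<close>. For a
      point of \<open>K\<close> at distance \<open>N\<close> at least 1 from \<open>x\<close>,
      \<open>N\<^sup>2 / (2 * t)\<close> is at most
      \<open>(\<bar>M - c'\<bar> + norm D) * N\<close>, whence \<open>N \<le> R - 1\<close>. Then
      \<open>S\<close> bounds the second component, from below by the minorant and from above by
      \<open>M\<close>.\<close>
    define c' where "c' = c + D \<bullet> x"
    define R where "R = 2 * t * norm D + 2 * t * \<bar>M - c'\<bar> + 1"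
    define S where "S = \<bar>c'\<bar> + norm D * R + \<bar>M\<bar>"
    have "w \<in> cball x R \<times> {-S..S}" if w: "w \<in> K" for w
    proof -
      obtain z r where zr: "w = (z, r)" by (cases w)
      define N where "N = norm (x - z)"
      have "\<Psi> z \<le> ereal r" using w zr by (auto simp: K_def ereal_epigraph_def)
      with minorant[of z] have "ereal (c + D \<bullet> z) \<le> ereal r" by (rule order_trans)
      then have "c + D \<bullet> z \<le> r" by simp
      moreover have "c + D \<bullet> z = c' - D \<bullet> (x - z)" by (simp add: c'_def inner_diff_right)
      moreover have "D \<bullet> (x - z) \<le> norm D * N"
        unfolding N_def by (rule norm_cauchy_schwarz)
      ultimately have lower: "c' - norm D * N \<le> r" by simp
      have upper: "r + N\<^sup>2 / (2 * t) \<le> M" using w zr by (auto simp: K_def h_def N_def)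
      have N0: "N \<ge> 0" by (simp add: N_def)
      have NR: "N \<le> R"
      proof (rule ccontr)
        assume "\<not> N \<le> R"
        then have NR: "R < N" by simp
        have "R \<ge> 1" using t by (simp add: R_def)
        with NR have N1: "N \<ge> 1" by simp
        have "N\<^sup>2 / (2 * t) \<le> (M - c') + norm D * N" using lower upper by simp
        also have "M - c' \<le> \<bar>M - c'\<bar> * 1" by simp
        also have "\<bar>M - c'\<bar> * 1 \<le> \<bar>M - c'\<bar> * N" using N1 by (intro mult_left_mono) auto
        finally have "N\<^sup>2 / (2 * t) \<le> (\<bar>M - c'\<bar> + norm D) * N" by (simp add: algebra_simps)
        then have "N * N \<le> (2 * t * (\<bar>M - c'\<bar> + norm D)) * N"
          using t by (simp add: field_simps power2_eq_square)
        then have "N \<le> 2 * t * (\<bar>M - c'\<bar> + norm D)" using N1 by simp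
        then show False using NR by (simp add: R_def algebra_simps)
      qed
      have "norm D * N \<le> norm D * R" using NR by (intro mult_left_mono) auto
      moreover have "0 \<le> N\<^sup>2 / (2 * t)" using t by simp
      moreover have "0 \<le> norm D * R" using NR N0 by simp
      ultimately have "- S \<le> r" "r \<le> S" using lower upper by (auto simp: S_def)
      then show ?thesis using NR zr by (simp add: N_def dist_norm)
    qed
    then have "K \<subseteq> cball x R \<times> {-S..S}" by blast
    then show ?thesis by (rule bounded_subset[rotated])
      (intro bounded_Times bounded_cball bounded_closed_interval)
  qed
  ultimately have "compact K" by (simp add: compact_eq_bounded_closed)
  moreover have "(q, a) \<in> K" using a by (simp add: K_def M_def ereal_epigraph_def)
  ultimately obtain w where w: "w \<in> K" "\<And>v. v \<in> K \<Longrightarrow> h w \<le> h v"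
    using continuous_attains_inf[of K h] cont by blast
  obtain p r where pr: "w = (p, r)" by (cases w)
  have "\<phi> p \<le> \<phi> u" for u
  proof -
    have "\<phi> p \<le> ereal (h w)"
      using w(1) pr add_right_mono[of "\<Psi> p" "ereal r" "ereal ((norm (x - p))\<^sup>2 / (2 * t))"]
      by (auto simp: \<phi>_def h_def K_def ereal_epigraph_def)
    also have "ereal (h w) \<le> \<phi> u"
    proof (cases "\<Psi> u")
      case (real s)
      \<comment> \<open>Points outside \<open>K\<close> have a value above \<open>M\<close>, and
        \<open>h w \<le> M\<close>.\<close>
      have "h w \<le> h (u, s)"
      proof (cases "h (u, s) \<le> M")
        case True
        then show ?thesis using w(2) real by (simp add: K_def ereal_epigraph_def)
      next
        case False
        then show ?thesis using w(1) by (simp add: K_def)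
      qed
      then show ?thesis using real by (simp add: \<phi>_def h_def)
    next
      case PInf
      then show ?thesis by (simp add: \<phi>_def)
    next
      case MInf
      then show ?thesis using minorant[of u] by simp
    qed
    finally show ?thesis .
  qed
  then have "is_arg_min \<phi> (\<lambda>_. True) p" by (auto simp: is_arg_min_def not_less)
  then have "is_arg_min \<phi> (\<lambda>_. True) (prox t \<Psi> x)"
    unfolding prox_def arg_min_def \<phi>_def[symmetric] by (rule someI)
  then show ?thesis by (auto simp: is_arg_min_def not_less \<phi>_def)
qed

lemma prox_subgradient:
  fixes \<Psi> :: "'a::euclidean_space \<Rightarrow> ereal"
  assumes t: "t > 0" and closed: "closed_fun \<Psi>" and conv: "convex_fun \<Psi>" and q: "\<Psi> q \<noteq> \<infinity>"
    and minorant: "\<And>z. ereal (c + D \<bullet> z) \<le> \<Psi> z"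
  obtains a where "\<Psi> (prox t \<Psi> x) = ereal a"
    and "\<And>z. ereal (a + (1 / t) * ((x - prox t \<Psi> x) \<bullet> (z - prox t \<Psi> x))) \<le> \<Psi> z"
proof -
  define p where "p = prox t \<Psi> x"
  define g where "g = (\<lambda>z. (norm (x - z))\<^sup>2 / (2 * t))"
  have min: "composite g \<Psi> p \<le> composite g \<Psi> u" for u
    using prox_minimizer[OF t closed q minorant, of x u]
    by (simp add: composite_def g_def p_def add.commute)
  have "\<Psi> p \<noteq> -\<infinity>" using minorant[of p] by auto
  moreover have "\<Psi> p \<noteq> \<infinity>"
    using min[of q] q by (auto simp: composite_def)
  ultimately obtain a where a: "\<Psi> p = ereal a" by (cases "\<Psi> p") auto
  \<comment> \<open>In fact an equality: the exact expansion of the quadratic at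
    \<open>p\<close>.\<close>
  have "g u \<le> g p + (- (1 / t) *\<^sub>R (x - p)) \<bullet> (u - p) + 1 / (2 * t) * (norm (u - p))\<^sup>2" for u
    using t by (simp add: g_def power2_norm_eq_inner inner_diff_left inner_diff_right
        inner_commute field_simps)
  from composite_minimizer_subgradient[OF conv a min this]
  have "ereal (a - (- (1 / t) *\<^sub>R (x - p)) \<bullet> (z - p)) \<le> \<Psi> z" for z .
  moreover have "a - (- (1 / t) *\<^sub>R (x - p)) \<bullet> (z - p) = a + (1 / t) * ((x - p) \<bullet> (z - p))" for z
    by (simp only: inner_scaleR_left)
  ultimately have "ereal (a + (1 / t) * ((x - p) \<bullet> (z - p))) \<le> \<Psi> z" for z
    by metis
  with a show ?thesis unfolding p_def by (rule that)
qed

section \<open>The descent inequality and the potential\<close>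

lemma prox_step_descent:
  fixes \<Psi> :: "'a::euclidean_space \<Rightarrow> ereal"
  assumes L: "L > 0" and smooth: "L_smooth L f" and convf: "convex_on UNIV f"
    and closed: "closed_fun \<Psi>" and conv: "convex_fun \<Psi>" and q: "\<Psi> q \<noteq> \<infinity>"
    and minorant: "\<And>z. ereal (c + D \<bullet> z) \<le> \<Psi> z"
  obtains v where "composite f \<Psi> (prox_step L f \<Psi> z) = ereal v"
    and "\<And>x. ereal (v + grad_map (1 / L) f \<Psi> z \<bullet> (x - z)
      + (norm (grad_map (1 / L) f \<Psi> z))\<^sup>2 / (2 * L)) \<le> composite f \<Psi> x"
proof -
  define d where "d = gradient f z"
  define p where "p = prox (1 / L) \<Psi> (z - (1 / L) *\<^sub>R d)"
  define G where "G = grad_map (1 / L) f \<Psi> z"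
  have G: "G = L *\<^sub>R (z - p)" by (simp add: G_def grad_map_def p_def d_def)
  have p_eq: "prox_step L f \<Psi> z = p"
    using L G by (simp add: prox_step_def G_def)
  obtain a where a: "\<Psi> p = ereal a"
    and sub: "\<And>x. ereal (a + L * ((z - (1 / L) *\<^sub>R d - p) \<bullet> (x - p))) \<le> \<Psi> x"
    using prox_subgradient[OF _ closed conv q minorant, of "1 / L" "z - (1 / L) *\<^sub>R d"] L
    by (auto simp: p_def)
  show ?thesis
  proof (rule that[of "f p + a"])
    show "composite f \<Psi> (prox_step L f \<Psi> z) = ereal (f p + a)"
      by (simp add: p_eq composite_def a)
    fix x
    have "f z + d \<bullet> (x - z) \<le> f x"
      unfolding d_def by (rule convex_L_smooth_gradient_le[OF smooth convf])
    moreover have "\<bar>f p - f z - d \<bullet> (p - z)\<bar> \<le> L / 2 * (norm (p - z))\<^sup>2"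
      using smooth by (simp add: L_smooth_def d_def)
    \<comment> \<open>The proximal subgradient of \<open>\<Psi>\<close> at \<open>p\<close> is
      \<open>G - d\<close>.\<close>
    moreover have "L * ((z - (1 / L) *\<^sub>R d - p) \<bullet> (x - p)) = G \<bullet> (x - p) - d \<bullet> (x - p)"
      using L by (simp add: G inner_diff_left algebra_simps)
    \<comment> \<open>Moving the base point from \<open>p\<close> to \<open>z\<close> gains
      \<open>(norm G)\<^sup>2 / L\<close>; the quadratic upper bound on \<open>f p\<close> uses up
      half of it.\<close>
    moreover have "G \<bullet> (x - p) = G \<bullet> (x - z) + L * (norm (p - z))\<^sup>2"
      by (simp add: G power2_norm_eq_inner inner_diff_left inner_diff_right inner_commute algebra_simps)
    moreover have "(norm G)\<^sup>2 / (2 * L) = L / 2 * (norm (p - z))\<^sup>2"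
      using L by (simp add: G power_mult_distrib norm_minus_commute power2_eq_square)
    moreover have "d \<bullet> (x - p) = d \<bullet> (x - z) - d \<bullet> (p - z)"
      by (simp add: inner_diff_right)
    ultimately have "f p + a + G \<bullet> (x - z) + (norm G)\<^sup>2 / (2 * L)
        \<le> f x + (a + L * ((z - (1 / L) *\<^sub>R d - p) \<bullet> (x - p)))"
      by linarith
    then have "ereal (f p + a + G \<bullet> (x - z) + (norm G)\<^sup>2 / (2 * L))
        \<le> ereal (f x) + ereal (a + L * ((z - (1 / L) *\<^sub>R d - p) \<bullet> (x - p)))"
      by simp
    also have "\<dots> \<le> ereal (f x) + \<Psi> x" by (rule add_left_mono[OF sub])
    finally show "ereal (f p + a + grad_map (1 / L) f \<Psi> z \<bullet> (x - z)
        + (norm (grad_map (1 / L) f \<Psi> z))\<^sup>2 / (2 * L)) \<le> composite f \<Psi> x"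
      by (simp add: G_def composite_def)
  qed
qed

text \<open>Here \<open>u\<close> and \<open>v\<close> stand for the gaps of \<open>F\<close> at the
  new and previous proximal points and \<open>\<kappa>\<close> for the index. With
  \<open>\<gamma> = (\<kappa> + 1) / (2 * L)\<close> the two weights are
  \<open>(\<kappa> + 2) * \<gamma>\<close> and \<open>\<kappa> * \<gamma>\<close>; their difference
  \<open>2 * \<gamma>\<close> is the coefficient of the cross term in the expanded square.\<close>

lemma geometric_descent_potential:
  fixes G x y z :: "'a::real_inner" and \<kappa> L u v :: real
  assumes L: "L > 0" and \<kappa>: "\<kappa> \<ge> 0"
    and y: "G \<bullet> (y - z) \<ge> 0"
    and u: "u + (norm G)\<^sup>2 / (2 * L) \<le> v"
    and x: "u + (norm G)\<^sup>2 / (2 * L) \<le> G \<bullet> (z - x)"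
  shows "(norm (y - ((\<kappa> + 1) / (2 * L)) *\<^sub>R G - x))\<^sup>2 + (\<kappa> + 1) * (\<kappa> + 2) / (2 * L) * u
    \<le> (norm (y - x))\<^sup>2 + \<kappa> * (\<kappa> + 1) / (2 * L) * v"
proof -
  define \<gamma> where "\<gamma> = (\<kappa> + 1) / (2 * L)"
  define n where "n = (norm G)\<^sup>2"
  have \<gamma>: "\<gamma> \<ge> 0" using L \<kappa> by (simp add: \<gamma>_def)
  have n: "n \<ge> 0" by (simp add: n_def)
  have "G \<bullet> (y - x) = G \<bullet> (y - z) + G \<bullet> (z - x)" by (simp add: inner_diff_right)
  with x y have "u + n / (2 * L) \<le> G \<bullet> (y - x)" by (simp add: n_def)
  then have 1: "\<gamma> * (u + n / (2 * L)) \<le> \<gamma> * (G \<bullet> (y - x))" using \<gamma> by (rule mult_left_mono)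
  have 2: "\<kappa> * \<gamma> * (u + n / (2 * L)) \<le> \<kappa> * \<gamma> * v"
    using u \<kappa> \<gamma> by (intro mult_left_mono) (auto simp: n_def)
  have "(norm (y - \<gamma> *\<^sub>R G - x))\<^sup>2 = (norm (y - x))\<^sup>2 - 2 * (\<gamma> * (G \<bullet> (y - x))) + \<gamma>\<^sup>2 * n"
  proof -
    have "(norm ((y - x) - \<gamma> *\<^sub>R G))\<^sup>2
        = (norm (y - x))\<^sup>2 + (norm (\<gamma> *\<^sub>R G))\<^sup>2 - 2 * ((y - x) \<bullet> (\<gamma> *\<^sub>R G))"
      using dot_norm_neg[of "y - x" "\<gamma> *\<^sub>R G"] by simp
    then show ?thesis
      unfolding cancel_ab_semigroup_add_class.diff_right_commute[of y "\<gamma> *\<^sub>R G" x]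
      by (simp add: n_def power_mult_distrib inner_commute)
  qed
  \<comment> \<open>The squared step costs \<open>\<kappa> + 1\<close> copies of
    \<open>\<gamma> * (n / (2 * L))\<close>; fact 1 taken twice and fact 2 supply
    \<open>\<kappa> + 2\<close>, leaving one as slack.\<close>
  moreover have "\<gamma>\<^sup>2 * n = \<kappa> * \<gamma> * (n / (2 * L)) + \<gamma> * (n / (2 * L))"
  proof -
    have "\<gamma>\<^sup>2 * n = \<gamma> * ((\<kappa> + 1) * (n / (2 * L)))"
      by (simp add: \<gamma>_def power2_eq_square)
    then show ?thesis by (simp only: distrib_left distrib_right mult_1 mult.left_commute mult.assoc)
  qed
  moreover have "0 \<le> \<gamma> * (n / (2 * L))" using \<gamma> n L by simp
  ultimately have "(norm (y - \<gamma> *\<^sub>R G - x))\<^sup>2 + \<gamma> * (\<kappa> + 2) * u \<le> (norm (y - x))\<^sup>2 + \<kappa> * \<gamma> * v"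
    using 1 2 unfolding distrib_left distrib_right by (simp add: mult.commute mult.left_commute)
  then show ?thesis by (simp add: \<gamma>_def mult.commute)
qed

theorem theorem7p4:
  fixes f :: "real ^ 'n \<Rightarrow> real" and \<Psi> :: "real ^ 'n \<Rightarrow> ereal"
    and L :: real and xs z0 y1 :: "real ^ 'n" and z y :: "nat \<Rightarrow> real ^ 'n"
  assumes "L > 0" and "L_smooth L f" and "convex_on UNIV f"
    and "closed_fun \<Psi>" and "proper_fun \<Psi>" and "convex_fun \<Psi>"
    and "is_arg_min (composite f \<Psi>) (\<lambda>_. True) xs"
    and "geometric_descent L f \<Psi> z0 y1 z y"
  shows "\<forall>k\<ge>1.
    ereal ((norm (y (k + 1) - xs))\<^sup>2)
      + ereal ((real k + 1) * (real k + 2) / (2 * L))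
          * (composite f \<Psi> (prox_step L f \<Psi> (z k)) - composite f \<Psi> xs)
    \<le> ereal ((norm (y k - xs))\<^sup>2)
      + ereal (real k * (real k + 1) / (2 * L))
          * (composite f \<Psi> (prox_step L f \<Psi> (z (k - 1))) - composite f \<Psi> xs)"
proof (intro allI impI)
  fix k :: nat assume k: "k \<ge> 1"
  have min: "composite f \<Psi> xs \<le> composite f \<Psi> u" for u
    using assms(7) by (simp add: is_arg_min_def not_less)
  obtain x0 where "\<Psi> x0 \<noteq> \<infinity>" using assms(5) by (auto simp: proper_fun_def)
  with min[of x0] have fin: "\<Psi> xs \<noteq> \<infinity>" by (auto simp: composite_def)
  moreover have "\<Psi> xs \<noteq> -\<infinity>" using assms(5) by (simp add: proper_fun_def)
  ultimately obtain a where a: "\<Psi> xs = ereal a" by (cases "\<Psi> xs") auto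
  define d where "d = gradient f xs"
  have "f u \<le> f xs + d \<bullet> (u - xs) + L / 2 * (norm (u - xs))\<^sup>2" for u
  proof -
    have "\<bar>f u - f xs - d \<bullet> (u - xs)\<bar> \<le> L / 2 * (norm (u - xs))\<^sup>2"
      using assms(2) by (simp add: L_smooth_def d_def)
    then show ?thesis by linarith
  qed
  \<comment> \<open>The subgradient \<open>- d\<close> of \<open>\<Psi>\<close> at
    \<open>xs\<close>, written as an affine function of \<open>u\<close>, is the minorant.\<close>
  from composite_minimizer_subgradient[OF assms(6) a min this]
  have minorant: "ereal ((a + d \<bullet> xs) + (- d) \<bullet> u) \<le> \<Psi> u" for u
    by (simp add: inner_diff_right algebra_simps)
  note descent = prox_step_descent[OF assms(1-4,6) fin minorant]
  define G where "G = grad_map (1 / L) f \<Psi> (z k)"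
  define p where "p = prox_step L f \<Psi> (z (k - 1))"
  obtain w where w: "composite f \<Psi> (prox_step L f \<Psi> (z k)) = ereal w"
    and w_le: "\<And>x. ereal (w + G \<bullet> (x - z k) + (norm G)\<^sup>2 / (2 * L)) \<le> composite f \<Psi> x"
    using descent[of "z k"] unfolding G_def by blast
  \<comment> \<open>Finite also for \<open>k = 1\<close>, where \<open>z 0\<close> may lie outside
    the domain of \<open>\<Psi>\<close>: \<open>p\<close> is a proximal point.\<close>
  obtain v where v: "composite f \<Psi> p = ereal v"
    using descent[of "z (k - 1)"] unfolding p_def by blast
  define m where "m = f xs + a"
  have m: "composite f \<Psi> xs = ereal m" by (simp add: composite_def a m_def)
  have run: "G \<bullet> (y k - z k) \<ge> 0" "G \<bullet> (p - z k) \<ge> 0"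
      "y (k + 1) = y k - ((real k + 1) / (2 * L)) *\<^sub>R G"
    using assms(8) k by (auto simp: geometric_descent_def G_def p_def)
  \<comment> \<open>The sign condition on \<open>p - z k\<close> lets the inner product be
    dropped.\<close>
  have at_p: "w - m + (norm G)\<^sup>2 / (2 * L) \<le> v - m" using w_le[of p] run(2) by (simp add: v)
  have "G \<bullet> (z k - xs) = - (G \<bullet> (xs - z k))" by (simp add: inner_diff_right)
  with w_le[of xs] have at_xs: "w - m + (norm G)\<^sup>2 / (2 * L) \<le> G \<bullet> (z k - xs)"
    by (simp add: m)
  from geometric_descent_potential[OF assms(1) _ run(1) at_p at_xs, of "real k"]
  show "ereal ((norm (y (k + 1) - xs))\<^sup>2)
      + ereal ((real k + 1) * (real k + 2) / (2 * L))
          * (composite f \<Psi> (prox_step L f \<Psi> (z k)) - composite f \<Psi> xs)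
    \<le> ereal ((norm (y k - xs))\<^sup>2)
      + ereal (real k * (real k + 1) / (2 * L))
          * (composite f \<Psi> (prox_step L f \<Psi> (z (k - 1))) - composite f \<Psi> xs)"
    unfolding w m v p_def[symmetric] run(3) by simp
qed

end
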